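(* Let $K\subseteq\mathbb{R}^n$ be a convex set with $B_2(0,1/\kappa)\subseteq K\subseteq B_2(0,1)$ for some $\kappa\ge1$. For any $0\le\eta<\frac12$, \[ \mathrm{SEP}_\eta(K)\le O\!\left(n\log\!\left(\frac{n\kappa}{\eta}\right)\right)\mathrm{MEM}_{(\eta/n\kappa)^{O(1)}}(K), \] i.e. a separation oracle for $K$ with parameter $\eta$ can be implemented using $O(n\log(n\kappa/\eta))$ calls to a membership oracle for $K$ with parameter $(\eta/(n\kappa))^{O(1)}$.
   Context: For $K\subseteq\mathbb{R}^n$ and $\delta\ge0$: $B(K,\delta)=\{x:\exists y\in K,\|x-y\|_2\le\delta\}$ and $B(K,-\delta)=\{x:B_2(x,\delta)\subseteq K\}$. Membership oracle with parameter $\delta>0$: queried with $y\in\mathbb{R}^n$, with probability $1-\delta$ it either asserts $y\in B(K,\delta)$ or asserts $y\notin B(K,-\delta)$; $\mathrm{MEM}_\delta(K)$ denotes its cost. Separation oracle with parameter $\delta>0$: queried with $y\in\mathbb{R}^n$, with probability $1-\delta$ it either asserts $y\in B(K,\delta)$ or finds a unit vector $c$ with $c^Tx\le c^Ty+\delta$ for all $x\in B(K,-\delta)$; $\mathrm{SEP}_\delta(K)$ denotes its cost. *)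

theory Defs
  imports "HOL-Probability.Probability"
begin

section \<open>Geometry of R^n for varying n\<close>

text \<open>
  Points of R^n are the elements of \<^term>\<open>topspace (Euclidean_space n)\<close>, that is, real sequences
  vanishing from index n on. The dimension is thus a term, so that constants can be chosen
  uniformly in n. Sequences carry no \<^class>\<open>real_vector\<close> structure in the library, hence the
  explicit norm, inner product and convexity.
\<close>

abbreviation Rn :: "nat \<Rightarrow> (nat \<Rightarrow> real) set"
  where "Rn n \<equiv> topspace (Euclidean_space n)"

definition norm2 :: "nat \<Rightarrow> (nat \<Rightarrow> real) \<Rightarrow> real"
  where "norm2 n x = L2_set x {..<n}"

definition inner2 :: "nat \<Rightarrow> (nat \<Rightarrow> real) \<Rightarrow> (nat \<Rightarrow> real) \<Rightarrow> real"
  where "inner2 n x y = (\<Sum>i<n. x i * y i)"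

definition ball2 :: "nat \<Rightarrow> (nat \<Rightarrow> real) \<Rightarrow> real \<Rightarrow> (nat \<Rightarrow> real) set"
  where "ball2 n x r = {y \<in> Rn n. norm2 n (\<lambda>i. x i - y i) \<le> r}"

definition convex_Rn :: "nat \<Rightarrow> (nat \<Rightarrow> real) set \<Rightarrow> bool"
  where "convex_Rn n K \<longleftrightarrow> K \<subseteq> Rn n \<and>
    (\<forall>x\<in>K. \<forall>y\<in>K. \<forall>u v. 0 \<le> u \<longrightarrow> 0 \<le> v \<longrightarrow> u + v = 1 \<longrightarrow> (\<lambda>i. u * x i + v * y i) \<in> K)"

text \<open>\<^term>\<open>outer n K \<delta>\<close> is B(K, \<delta>) and \<^term>\<open>inner_core n K \<delta>\<close> is B(K, -\<delta>).\<close>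

definition outer :: "nat \<Rightarrow> (nat \<Rightarrow> real) set \<Rightarrow> real \<Rightarrow> (nat \<Rightarrow> real) set"
  where "outer n K \<delta> = {x \<in> Rn n. \<exists>y\<in>K. norm2 n (\<lambda>i. x i - y i) \<le> \<delta>}"

definition inner_core :: "nat \<Rightarrow> (nat \<Rightarrow> real) set \<Rightarrow> real \<Rightarrow> (nat \<Rightarrow> real) set"
  where "inner_core n K \<delta> = {x \<in> Rn n. ball2 n x \<delta> \<subseteq> K}"


section \<open>Randomized membership and separation oracles\<close>

text \<open>
  A randomized oracle with answers in \<^typ>\<open>'a\<close> is given the list of earlier queries with
  the answers they received (oldest first) and the current query, and returns a distribution on
  answers. The success probability required below is therefore conditional on the past: every call
  uses fresh randomness, but answers may otherwise depend on the history.
\<close>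

type_synonym 'a oracle_fn =
  "((nat \<Rightarrow> real) \<times> 'a) list \<Rightarrow> (nat \<Rightarrow> real) \<Rightarrow> 'a pmf"

text \<open>
  The answer \<^term>\<open>True\<close> asserts membership in B(K, \<delta>), the answer \<^term>\<open>False\<close> asserts
  non-membership in B(K, -\<delta>). For a query in both regions either answer is correct.
\<close>

definition mem_answer_ok ::
    "nat \<Rightarrow> (nat \<Rightarrow> real) set \<Rightarrow> real \<Rightarrow> (nat \<Rightarrow> real) \<Rightarrow> bool \<Rightarrow> bool"
  where "mem_answer_ok n K \<delta> y b \<longleftrightarrow> (if b then y \<in> outer n K \<delta> else y \<notin> inner_core n K \<delta>)"

definition mem_oracle :: "nat \<Rightarrow> (nat \<Rightarrow> real) set \<Rightarrow> real \<Rightarrow> bool oracle_fn \<Rightarrow> bool"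
  where "mem_oracle n K \<delta> orc \<longleftrightarrow>
    (\<forall>h. \<forall>y\<in>Rn n. measure_pmf.prob (orc h y) {b. mem_answer_ok n K \<delta> y b} \<ge> 1 - \<delta>)"

datatype sep_answer = Inside | Separator "nat \<Rightarrow> real"

fun sep_answer_ok ::
    "nat \<Rightarrow> (nat \<Rightarrow> real) set \<Rightarrow> real \<Rightarrow> (nat \<Rightarrow> real) \<Rightarrow> sep_answer \<Rightarrow> bool"
  where
    "sep_answer_ok n K \<delta> y Inside \<longleftrightarrow> y \<in> outer n K \<delta>"
  | "sep_answer_ok n K \<delta> y (Separator c) \<longleftrightarrow>
       c \<in> Rn n \<and> norm2 n c = 1 \<and> (\<forall>x\<in>inner_core n K \<delta>. inner2 n c x \<le> inner2 n c y + \<delta>)"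


section \<open>Algorithms with oracle access\<close>

text \<open>
  A randomized algorithm that learns about the body only through yes/no answers to its queries.
  Its own coins come from arbitrary discrete distributions, encoded on the natural numbers.
  Arithmetic is free; only oracle calls are counted.
\<close>

datatype 'r alg =
    Return 'r
  | Query "nat \<Rightarrow> real" "bool \<Rightarrow> 'r alg"
  | Sample "nat pmf" "nat \<Rightarrow> 'r alg"

primrec run :: "bool oracle_fn \<Rightarrow> 'r alg \<Rightarrow> ((nat \<Rightarrow> real) \<times> bool) list \<Rightarrow> 'r pmf"
  where
    "run orc (Return r) h = return_pmf r"
  | "run orc (Query y k) h = bind_pmf (orc h y) (\<lambda>b. run orc (k b) (h @ [(y, b)]))"
  | "run orc (Sample p k) h = bind_pmf p (\<lambda>i. run orc (k i) h)"

text \<open>The number of oracle calls on the worst run, over all coin flips and all answers.\<close>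

primrec calls :: "'r alg \<Rightarrow> enat"
  where
    "calls (Return r) = 0"
  | "calls (Query y k) = eSuc (max (calls (k True)) (calls (k False)))"
  | "calls (Sample p k) = (SUP i\<in>set_pmf p. calls (k i))"

text \<open>
  The algorithm family A (one algorithm for each point y to be separated) implements a separation
  oracle with parameter \<eta> for every body K of the class \<K>, given any membership oracle for K with
  parameter \<delta>. The same A serves the whole class, so that all information about K has to come from
  the oracle.
\<close>

definition implements_sep ::
    "nat \<Rightarrow> (nat \<Rightarrow> real) set set \<Rightarrow> real \<Rightarrow> real \<Rightarrow> ((nat \<Rightarrow> real) \<Rightarrow> sep_answer alg) \<Rightarrow> bool"
  where "implements_sep n \<K> \<eta> \<delta> A \<longleftrightarrow>
    (\<forall>K\<in>\<K>. \<forall>orc. mem_oracle n K \<delta> orc \<longrightarrow>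
      (\<forall>y\<in>Rn n. measure_pmf.prob (run orc (A y) []) {s. sep_answer_ok n K \<eta> y s} \<ge> 1 - \<eta>))"

text \<open>
  The cost of a separation oracle with parameter \<eta>, in units of calls to a membership oracle with
  parameter \<delta>. It is infinite if no algorithm with a bounded number of calls exists; as
  \<^typ>\<open>enat\<close> is well-ordered, a finite infimum is attained by some algorithm.
\<close>

definition sep_cost :: "nat \<Rightarrow> (nat \<Rightarrow> real) set set \<Rightarrow> real \<Rightarrow> real \<Rightarrow> enat"
  where "sep_cost n \<K> \<eta> \<delta> = (INF A\<in>{A. implements_sep n \<K> \<eta> \<delta> A}. SUP y\<in>Rn n. calls (A y))"

text \<open>log(a / \<eta>) for a > 0, with the value \<infinity> at \<eta> = 0 (where HOL division would give 0).\<close>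

definition log_ratio :: "real \<Rightarrow> real \<Rightarrow> ereal"
  where "log_ratio a \<eta> = (if \<eta> = 0 then \<infinity> else ereal (ln (a / \<eta>)))"

end

theory Submission
  imports Defs
begin

text \<open>
  Let f be the Minkowski gauge of K. It is sublinear and \<kappa>-Lipschitz, and a membership query at
  z / t compares f(z) with t up to an error t \<kappa> \<delta>, so bisection evaluates f with logarithmically
  many queries. If f(z) \<ge> 1 at a point z near y, every subgradient of f at z separates y from K, and
  it suffices to know f at z and at its n forward neighbours z + h e_i, provided that the second
  differences of f at z are small compared with h. To ensure this, z is drawn uniformly from a
  grid of step h near y: along every grid line the second differences telescope to at most 2 \<kappa> h,
  and they are nonnegative by convexity, so Markov's inequality bounds their sum over i.
\<close>

text \<open>Two length scales compete. The grid has side h M, which must be at most about \<eta> /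
  (n \<kappa>) so that the gauge hardly changes between y and z. The average second difference is at
  most 2 \<kappa> h / M per coordinate, and it must be small against h \<eta>, which forces M to be
  large. A polynomial M in n \<kappa> / \<eta> suffices and costs no queries, since only one grid
  point is ever used; the logarithm in the bound comes solely from the n + 1 bisections. The gauge
  need not be differentiable. A second difference divided by h is the gap between forward and
  backward slope, so controlling it replaces smoothness. Normalizing the estimated gradient g could
  blow up its error. Testing the subgradient inequality at the origin, where the gauge vanishes,
  bounds g . z and hence the norm of g from below.\<close>

section \<open>Euclidean norm and inner product on sequences\<close>

lemma Rn_iff: "x \<in> Rn n \<longleftrightarrow> (\<forall>i\<ge>n. x i = 0)"
  by (auto simp: topspace_Euclidean_space)

lemma norm2_nonneg [simp]: "norm2 n x \<ge> 0"
  by (simp add: norm2_def)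

lemma norm2_scale: "norm2 n (\<lambda>i. a * x i) = \<bar>a\<bar> * norm2 n x"
proof -
  have "norm2 n (\<lambda>i. a * x i) = norm2 n (\<lambda>i. \<bar>a\<bar> * x i)"
    by (simp add: norm2_def L2_set_def power_mult_distrib)
  then show ?thesis
    by (simp add: norm2_def L2_set_right_distrib)
qed

lemma norm2_divide: "t > 0 \<Longrightarrow> norm2 n (\<lambda>i. x i / t) = norm2 n x / t"
  using norm2_scale[of n "1 / t" x] by simp

lemma norm2_triangle: "norm2 n (\<lambda>i. x i + y i) \<le> norm2 n x + norm2 n y"
  by (simp add: norm2_def L2_set_triangle_ineq)

lemma norm2_minus_commute: "norm2 n (\<lambda>i. x i - y i) = norm2 n (\<lambda>i. y i - x i)"
  by (simp add: norm2_def L2_set_def power2_commute)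

lemma norm2_le_add_diff: "norm2 n x \<le> norm2 n y + norm2 n (\<lambda>i. x i - y i)"
  using norm2_triangle[of n y "\<lambda>i. x i - y i"] by simp

lemma abs_le_norm2: "i < n \<Longrightarrow> \<bar>x i\<bar> \<le> norm2 n x"
  using member_le_L2_set[of "{..<n}" i "\<lambda>i. \<bar>x i\<bar>"]
  by (simp add: norm2_def L2_set_def)

lemma norm2_le_sum: "norm2 n x \<le> (\<Sum>i<n. \<bar>x i\<bar>)"
  unfolding norm2_def by (rule L2_set_le_sum_abs)

lemma inner2_le: "inner2 n x y \<le> norm2 n x * norm2 n y"
proof -
  have "inner2 n x y \<le> (\<Sum>i<n. \<bar>x i\<bar> * \<bar>y i\<bar>)"
    unfolding inner2_def by (rule sum_mono) (metis abs_ge_self abs_mult)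
  also have "\<dots> \<le> norm2 n x * norm2 n y"
    unfolding norm2_def by (rule L2_set_mult_ineq)
  finally show ?thesis .
qed

lemma inner_core_subset:
  assumes "\<delta> \<ge> 0"
  shows "inner_core n K \<delta> \<subseteq> K"
  using assms by (auto simp: inner_core_def ball2_def norm2_def L2_set_def)


section \<open>The gauge of a round convex body\<close>

definition minkowski :: "(nat \<Rightarrow> real) set \<Rightarrow> (nat \<Rightarrow> real) \<Rightarrow> real"
  where "minkowski K x = Inf {t. t > 0 \<and> (\<lambda>i. x i / t) \<in> K}"

locale round_body =
  fixes n :: nat and \<kappa> :: real and K :: "(nat \<Rightarrow> real) set"
  assumes \<kappa>: "\<kappa> \<ge> 1"
    and convex: "convex_Rn n K"
    and ball_subset: "ball2 n (\<lambda>_. 0) (1 / \<kappa>) \<subseteq> K"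
    and subset_ball: "K \<subseteq> ball2 n (\<lambda>_. 0) 1"
begin

lemma K_Rn: "x \<in> K \<Longrightarrow> x \<in> Rn n"
  using convex by (auto simp: convex_Rn_def)

lemma convexD:
  "x \<in> K \<Longrightarrow> y \<in> K \<Longrightarrow> 0 \<le> u \<Longrightarrow> 0 \<le> v \<Longrightarrow> u + v = 1 \<Longrightarrow> (\<lambda>i. u * x i + v * y i) \<in> K"
  using convex by (auto simp: convex_Rn_def)

lemma norm_le_1: "x \<in> K \<Longrightarrow> norm2 n x \<le> 1"
  using subset_ball by (auto simp: ball2_def norm2_def L2_set_def)

lemma mem_K_of_norm:
  assumes "x \<in> Rn n" "norm2 n x \<le> 1 / \<kappa>"
  shows "x \<in> K"
proof -
  have "x \<in> ball2 n (\<lambda>_. 0) (1 / \<kappa>)"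
    using assms by (simp add: ball2_def norm2_def L2_set_def)
  then show ?thesis using ball_subset by blast
qed

lemma zero_mem: "(\<lambda>_. 0) \<in> K"
  by (rule mem_K_of_norm) (use \<kappa> in \<open>auto simp: Rn_iff norm2_def L2_set_def\<close>)

lemma divide_mem:
  assumes "x \<in> Rn n" "t > 0" "t \<ge> \<kappa> * norm2 n x"
  shows "(\<lambda>i. x i / t) \<in> K"
proof (rule mem_K_of_norm)
  show "(\<lambda>i. x i / t) \<in> Rn n"
    using assms by (simp add: Rn_iff)
  show "norm2 n (\<lambda>i. x i / t) \<le> 1 / \<kappa>"
    using assms \<kappa> by (simp add: norm2_divide field_simps)
qed

text \<open>x / t lies on the segment from 0 to x / s; the admissible scalings thus form an upward
  closed set.\<close>

lemma divide_mono:
  assumes "(\<lambda>i. x i / s) \<in> K" "0 < s" "s \<le> t"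
  shows "(\<lambda>i. x i / t) \<in> K"
  using convexD[OF assms(1) zero_mem, of "s / t" "1 - s / t"] assms by simp

lemma bdd_below_minkowski: "bdd_below {t. t > 0 \<and> (\<lambda>i. x i / t) \<in> K}"
  by (rule bdd_belowI[of _ 0]) auto

lemma minkowski_le: "(\<lambda>i. x i / t) \<in> K \<Longrightarrow> t > 0 \<Longrightarrow> minkowski K x \<le> t"
  unfolding minkowski_def by (rule cInf_lower) (auto simp: bdd_below_minkowski)

lemma minkowski_set_nonempty:
  assumes "x \<in> Rn n"
  shows "{t. t > 0 \<and> (\<lambda>i. x i / t) \<in> K} \<noteq> {}"
proof -
  \<comment> \<open>The summand 1 keeps the scaling positive also at x = 0.\<close>
  have "0 < \<kappa> * norm2 n x + 1"
    using \<kappa> by (simp add: add_nonneg_pos)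
  then show ?thesis using divide_mem[OF assms, of "\<kappa> * norm2 n x + 1"] by auto
qed

lemma minkowski_nonneg: "x \<in> Rn n \<Longrightarrow> minkowski K x \<ge> 0"
  unfolding minkowski_def by (rule cInf_greatest[OF minkowski_set_nonempty]) auto

text \<open>The inequality is strict because K need not be closed, so the infimum may not be
  attained. This is why the bounds below are proved up to an arbitrary e > 0.\<close>

lemma divide_mem_of_minkowski_less:
  assumes "x \<in> Rn n" "minkowski K x < t"
  shows "(\<lambda>i. x i / t) \<in> K"
proof -
  obtain s where "s > 0" "(\<lambda>i. x i / s) \<in> K" "s < t"
    using assms(2) cInf_lessD[OF minkowski_set_nonempty[OF assms(1)], of t]
    unfolding minkowski_def by auto
  then show ?thesis using divide_mono[of x s t] by simp
qed

lemma minkowski_le_norm: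
  assumes "x \<in> Rn n"
  shows "minkowski K x \<le> \<kappa> * norm2 n x"
proof (rule field_le_epsilon)
  fix e :: real
  assume "e > 0"
  then have "0 < \<kappa> * norm2 n x + e"
    using \<kappa> by (simp add: add_nonneg_pos)
  then show "minkowski K x \<le> \<kappa> * norm2 n x + e"
    using divide_mem[OF assms, of "\<kappa> * norm2 n x + e"] \<open>e > 0\<close> by (intro minkowski_le) auto
qed

lemma minkowski_le_1: "x \<in> K \<Longrightarrow> minkowski K x \<le> 1"
  using minkowski_le[of x 1] by simp

lemma minkowski_zero: "minkowski K (\<lambda>_. 0) = 0"
  using minkowski_le_norm[of "\<lambda>_. 0"] minkowski_nonneg[of "\<lambda>_. 0"]
  by (simp add: Rn_iff norm2_def L2_set_def)

lemma minkowski_scale_le: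
  assumes "x \<in> Rn n" "s > 0"
  shows "minkowski K (\<lambda>i. s * x i) \<le> s * minkowski K x"
proof (rule field_le_epsilon)
  fix e :: real
  assume "e > 0"
  have g: "minkowski K x < minkowski K x + e / s"
    using \<open>e > 0\<close> assms by simp
  have "(\<lambda>i. s * x i / (s * (minkowski K x + e / s))) \<in> K"
    using divide_mem_of_minkowski_less[OF assms(1) g] assms by simp
  then have "minkowski K (\<lambda>i. s * x i) \<le> s * (minkowski K x + e / s)"
    using minkowski_nonneg[OF assms(1)] assms \<open>e > 0\<close>
    by (intro minkowski_le) (auto intro!: mult_pos_pos add_nonneg_pos)
  then show "minkowski K (\<lambda>i. s * x i) \<le> s * minkowski K x + e"
    using assms by (simp add: algebra_simps)
qed

lemma minkowski_scale:
  assumes "x \<in> Rn n" "s \<ge> 0"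
  shows "minkowski K (\<lambda>i. s * x i) = s * minkowski K x"
proof (cases "s = 0")
  case True
  then show ?thesis by (simp add: minkowski_zero)
next
  case False
  then have s: "s > 0" using assms by simp
  \<comment> \<open>The converse inequality is the same one for the factor 1 / s at the point s
    x.\<close>
  have "minkowski K (\<lambda>i. (1 / s) * (s * x i)) \<le> (1 / s) * minkowski K (\<lambda>i. s * x i)"
    using assms s by (intro minkowski_scale_le) (auto simp: Rn_iff)
  then have "s * minkowski K x \<le> minkowski K (\<lambda>i. s * x i)"
    using s by (simp add: field_simps)
  then show ?thesis using minkowski_scale_le[OF assms(1) s] by simp
qed

text \<open>(x + y) / (s + t) is the convex combination of x / s and y / t with weights proportional
  to s and t.\<close>

lemma minkowski_add:
  assumes "x \<in> Rn n" "y \<in> Rn n"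
  shows "minkowski K (\<lambda>i. x i + y i) \<le> minkowski K x + minkowski K y"
proof (rule field_le_epsilon)
  fix e :: real
  assume e: "e > 0"
  define s t where "s = minkowski K x + e / 2" and "t = minkowski K y + e / 2"
  have st: "s > 0" "t > 0"
    using minkowski_nonneg[OF assms(1)] minkowski_nonneg[OF assms(2)] e by (auto simp: s_def t_def)
  have "(\<lambda>i. x i / s) \<in> K" "(\<lambda>i. y i / t) \<in> K"
    using e by (auto intro!: divide_mem_of_minkowski_less assms simp: s_def t_def)
  then have "(\<lambda>i. s / (s + t) * (x i / s) + t / (s + t) * (y i / t)) \<in> K"
    using st by (intro convexD) (auto simp flip: add_divide_distrib)
  also have "(\<lambda>i. s / (s + t) * (x i / s) + t / (s + t) * (y i / t)) = (\<lambda>i. (x i + y i) / (s + t))"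
    using st by (auto simp: add_divide_distrib)
  finally show "minkowski K (\<lambda>i. x i + y i) \<le> minkowski K x + minkowski K y + e"
    using minkowski_le[of "\<lambda>i. x i + y i" "s + t"] st by (simp add: s_def t_def)
qed

lemma minkowski_sum:
  assumes "finite I" "\<And>j. j \<in> I \<Longrightarrow> v j \<in> Rn n"
  shows "minkowski K (\<lambda>i. \<Sum>j\<in>I. v j i) \<le> (\<Sum>j\<in>I. minkowski K (v j))"
  using assms
proof (induction I rule: finite_induct)
  case empty
  then show ?case by (simp add: minkowski_zero)
next
  case (insert j I)
  have "minkowski K (\<lambda>i. v j i + (\<Sum>j\<in>I. v j i)) \<le> minkowski K (v j) + minkowski K (\<lambda>i. \<Sum>j\<in>I. v j i)"
    using insert.prems by (intro minkowski_add) (auto simp: Rn_iff)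
  also have "\<dots> \<le> minkowski K (v j) + (\<Sum>j\<in>I. minkowski K (v j))"
    using insert.IH insert.prems by auto
  finally show ?case using insert.hyps by simp
qed

lemma minkowski_Lipschitz:
  assumes "x \<in> Rn n" "y \<in> Rn n"
  shows "minkowski K x \<le> minkowski K y + \<kappa> * norm2 n (\<lambda>i. x i - y i)"
proof -
  have d: "(\<lambda>i. x i - y i) \<in> Rn n"
    using assms by (auto simp: Rn_iff)
  show ?thesis
    using minkowski_add[OF assms(2) d] minkowski_le_norm[OF d] by simp
qed

text \<open>The oracle errs by a distance, which the Lipschitz bound turns into a gauge error. For a
  negative answer: a gauge below 1 - \<kappa> \<delta> would put the whole \<delta>-ball around q
  into K.\<close>

lemma mem_answer_minkowski:
  assumes "mem_answer_ok n K \<delta> q b" "q \<in> Rn n"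
  shows "if b then minkowski K q \<le> 1 + \<kappa> * \<delta> else minkowski K q \<ge> 1 - \<kappa> * \<delta>"
proof (cases b)
  case True
  then obtain y where y: "y \<in> K" "norm2 n (\<lambda>i. q i - y i) \<le> \<delta>"
    using assms by (auto simp: mem_answer_ok_def outer_def)
  have "minkowski K q \<le> minkowski K y + \<kappa> * norm2 n (\<lambda>i. q i - y i)"
    using minkowski_Lipschitz assms(2) K_Rn y by blast
  also have "\<dots> \<le> 1 + \<kappa> * \<delta>"
    using minkowski_le_1 y \<kappa> by (intro add_mono mult_left_mono) auto
  finally show ?thesis using True by simp
next
  case False
  have "q \<in> inner_core n K \<delta>" if less: "minkowski K q < 1 - \<kappa> * \<delta>"
    unfolding inner_core_def
  proof (intro CollectI conjI subsetI assms(2))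
    fix y
    assume "y \<in> ball2 n q \<delta>"
    then have y: "y \<in> Rn n" "norm2 n (\<lambda>i. y i - q i) \<le> \<delta>"
      using norm2_minus_commute[of n q y] by (auto simp: ball2_def)
    have "minkowski K y \<le> minkowski K q + \<kappa> * norm2 n (\<lambda>i. y i - q i)"
      by (rule minkowski_Lipschitz[OF y(1) assms(2)])
    also have "\<dots> < 1"
      using less mult_left_mono[OF y(2), of \<kappa>] \<kappa> by linarith
    finally show "y \<in> K"
      using divide_mem_of_minkowski_less[OF y(1)] by force
  qed
  then show ?thesis using assms False by (force simp: mem_answer_ok_def)
qed

end


section \<open>Sequential composition and the union bound\<close>

primrec bind_alg :: "'a alg \<Rightarrow> ('a \<Rightarrow> 'b alg) \<Rightarrow> 'b alg"
  where
    "bind_alg (Return r) f = f r"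
  | "bind_alg (Query y k) f = Query y (\<lambda>b. bind_alg (k b) f)"
  | "bind_alg (Sample p k) f = Sample p (\<lambda>i. bind_alg (k i) f)"

text \<open>Correctness without probability: the result is good whenever all answers are, for every
  choice of coins. Queries are confined to \<open>Rn n\<close>, where the oracle gives its
  guarantee.\<close>

primrec outcome_ok ::
    "nat \<Rightarrow> ((nat \<Rightarrow> real) \<Rightarrow> bool \<Rightarrow> bool) \<Rightarrow> ('r \<Rightarrow> bool) \<Rightarrow> 'r alg \<Rightarrow> bool"
  where
    "outcome_ok n ok P (Return r) \<longleftrightarrow> P r"
  | "outcome_ok n ok P (Query y k) \<longleftrightarrow> y \<in> Rn n \<and> (\<forall>b. ok y b \<longrightarrow> outcome_ok n ok P (k b))"
  | "outcome_ok n ok P (Sample p k) \<longleftrightarrow> (\<forall>i\<in>set_pmf p. outcome_ok n ok P (k i))"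

lemma outcome_ok_bind:
  assumes "outcome_ok n ok P a" "\<And>r. P r \<Longrightarrow> outcome_ok n ok Q (f r)"
  shows "outcome_ok n ok Q (bind_alg a f)"
  using assms(1) by (induction a) (auto intro: assms(2))

lemma calls_bind_le:
  assumes "calls a \<le> enat k" "\<And>r. calls (f r) \<le> enat l"
  shows "calls (bind_alg a f) \<le> enat (k + l)"
  using assms(1)
proof (induction a arbitrary: k)
  case (Return r)
  then show ?case using order_trans[OF assms(2)[of r], of "enat (k + l)"] by simp
next
  case (Query y c)
  then obtain k' where k': "k = Suc k'"
    by (cases k) (auto simp: zero_enat_def[symmetric])
  have "calls (c b) \<le> enat k'" for b
    using Query.prems by (cases b) (auto simp: k' simp flip: eSuc_enat)
  then have "calls (bind_alg (c b) f) \<le> enat (k' + l)" for b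
    by (intro Query.IH) auto
  then show ?case by (simp add: k' flip: eSuc_enat)
next
  case (Sample p c)
  have "calls (c i) \<le> enat k" if "i \<in> set_pmf p" for i
    using Sample.prems that by (simp add: SUP_le_iff)
  then show ?case using Sample.IH by (auto intro!: SUP_least)
qed

lemma measure_bind_pmf:
  "measure_pmf.prob (bind_pmf p f) S = measure_pmf.expectation p (\<lambda>x. measure_pmf.prob (f x) S)"
proof -
  have "integrable (measure_pmf p) (\<lambda>x. measure_pmf.prob (f x) S)"
    by (rule measure_pmf.integrable_const_bound[where B = 1]) auto
  then have "ennreal (measure_pmf.prob (bind_pmf p f) S)
      = ennreal (measure_pmf.expectation p (\<lambda>x. measure_pmf.prob (f x) S))"
    by (simp add: nn_integral_eq_integral flip: measure_pmf.emeasure_eq_measure)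
      (simp add: measure_pmf.emeasure_eq_measure nn_integral_eq_integral)
  then show ?thesis
    by (simp add: Bochner_Integration.integral_nonneg)
qed

text \<open>Integrates the pointwise bound \<open>indicator A x - \<beta>\<close>, which off A holds
  because probabilities are nonnegative. The losses then add up rather than multiply.\<close>

lemma prob_bind_pmf_ge:
  assumes "measure_pmf.prob p A \<ge> 1 - \<alpha>"
    and "\<And>x. x \<in> A \<Longrightarrow> x \<in> set_pmf p \<Longrightarrow> measure_pmf.prob (f x) S \<ge> 1 - \<beta>"
    and "\<beta> \<ge> 0"
  shows "measure_pmf.prob (bind_pmf p f) S \<ge> 1 - (\<alpha> + \<beta>)"
proof -
  have "1 - (\<alpha> + \<beta>) \<le> measure_pmf.prob p A - \<beta>"
    using assms(1) by simp
  also have "\<dots> = measure_pmf.expectation p (\<lambda>x. indicator A x - \<beta>)"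
    by (subst Bochner_Integration.integral_diff)
      (auto intro!: measure_pmf.integrable_const_bound[where B = 1])
  also have "\<dots> \<le> measure_pmf.expectation p (\<lambda>x. measure_pmf.prob (f x) S)"
  proof (rule integral_mono_AE)
    show "integrable (measure_pmf p) (\<lambda>x. measure_pmf.prob (f x) S)"
      by (rule measure_pmf.integrable_const_bound[where B = 1]) auto
    show "AE x in measure_pmf p. indicator A x - \<beta> \<le> measure_pmf.prob (f x) S"
      unfolding AE_measure_pmf_iff
    proof
      fix x
      assume x: "x \<in> set_pmf p"
      have "- \<beta> \<le> measure_pmf.prob (f x) S"
        using assms(3) measure_nonneg[of "measure_pmf (f x)" S] by linarith
      then show "indicator A x - \<beta> \<le> measure_pmf.prob (f x) S"
        using assms(2)[OF _ x] by (cases "x \<in> A") auto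
    qed
  qed (auto intro!: measure_pmf.integrable_const_bound[where B = "1 + \<bar>\<beta>\<bar>"] AE_I2
        split: split_indicator)
  also have "\<dots> = measure_pmf.prob (bind_pmf p f) S"
    by (rule measure_bind_pmf[symmetric])
  finally show ?thesis .
qed

text \<open>
  Each call has failure probability at most \<delta> conditionally on the history, so the union bound
  applies to the adaptively chosen queries.
\<close>

lemma prob_run_ge:
  assumes orc: "mem_oracle n K \<delta> orc" and "\<delta> \<ge> 0"
    and "outcome_ok n (mem_answer_ok n K \<delta>) P a" "calls a \<le> enat N"
  shows "measure_pmf.prob (run orc a h) {r. P r} \<ge> 1 - real N * \<delta>"
  using assms(3,4)
proof (induction a arbitrary: N h)
  case (Return r)
  then show ?case using \<open>\<delta> \<ge> 0\<close> by simp
next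
  case (Query y k)
  then obtain N' where N: "N = Suc N'"
    by (cases N) (auto simp: zero_enat_def[symmetric])
  have calls: "calls (k b) \<le> enat N'" for b
    using Query.prems by (cases b) (auto simp: N simp flip: eSuc_enat)
  have "measure_pmf.prob (run orc (Query y k) h) {r. P r} \<ge> 1 - (\<delta> + real N' * \<delta>)"
    unfolding run.simps
  proof (rule prob_bind_pmf_ge)
    show "1 - \<delta> \<le> measure_pmf.prob (orc h y) {b. mem_answer_ok n K \<delta> y b}"
      using orc Query.prems by (simp add: mem_oracle_def)
  qed (use Query.prems calls \<open>\<delta> \<ge> 0\<close> in \<open>auto intro!: Query.IH\<close>)
  then show ?case by (simp add: N algebra_simps)
next
  case (Sample p k)
  have calls: "calls (k i) \<le> enat N" if "i \<in> set_pmf p" for i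
    using Sample.prems that by (simp add: SUP_le_iff)
  \<comment> \<open>The coins contribute no failure: every value in their support is
    acceptable.\<close>
  have "measure_pmf.prob (run orc (Sample p k) h) {r. P r} \<ge> 1 - (0 + real N * \<delta>)"
    unfolding run.simps
    by (rule prob_bind_pmf_ge[where A = UNIV])
      (use Sample.prems calls \<open>\<delta> \<ge> 0\<close> in \<open>auto intro!: Sample.IH\<close>)
  then show ?case by simp
qed


section \<open>Estimating the gauge by bisection\<close>

text \<open>Divisors are midpoints only, and these are positive once hi is, so the search may start
  at lo = 0.\<close>

primrec bsearch :: "nat \<Rightarrow> (nat \<Rightarrow> real) \<Rightarrow> real \<Rightarrow> real \<Rightarrow> real alg"
  where
    "bsearch 0 z lo hi = Return lo"
  | "bsearch (Suc m) z lo hi =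
       Query (\<lambda>i. z i / ((lo + hi) / 2))
         (\<lambda>b. if b then bsearch m z lo ((lo + hi) / 2) else bsearch m z ((lo + hi) / 2) hi)"

lemma calls_bsearch: "calls (bsearch m z lo hi) = enat m"
  by (induction m arbitrary: lo hi) (auto simp: zero_enat_def eSuc_enat)

text \<open>Query errors do not accumulate: each new end t of the bracket is compared with z
  directly and is off by at most t \<kappa> \<delta>. The invariant is that the bracket, widened by
  T \<kappa> \<delta>, contains the gauge; the fixed bound T keeps this margin constant.\<close>

lemma (in round_body) bsearch_ok:
  assumes "z \<in> Rn n" "\<delta> \<ge> 0" "0 \<le> lo" "lo < hi" "hi \<le> T"
    and "lo - T * \<kappa> * \<delta> \<le> minkowski K z" "minkowski K z \<le> hi + T * \<kappa> * \<delta>"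
  shows "outcome_ok n (mem_answer_ok n K \<delta>)
           (\<lambda>r. \<bar>r - minkowski K z\<bar> \<le> (hi - lo) / 2 ^ m + T * \<kappa> * \<delta>) (bsearch m z lo hi)"
  using assms(3-)
proof (induction m arbitrary: lo hi)
  case 0
  then show ?case by auto
next
  case (Suc m)
  define t where "t = (lo + hi) / 2"
  have t: "0 < t" "lo < t" "t < hi" "t \<le> T"
    using Suc.prems by (auto simp: t_def)
  have q: "(\<lambda>i. z i / t) \<in> Rn n"
    using assms(1) by (simp add: Rn_iff)
  have z: "minkowski K z = t * minkowski K (\<lambda>i. z i / t)"
    using minkowski_scale[OF q, of t] t by simp
  have err: "t * (\<kappa> * \<delta>) \<le> T * \<kappa> * \<delta>"
    using t \<kappa> \<open>\<delta> \<ge> 0\<close> mult_right_mono[of t T "\<kappa> * \<delta>"] by (simp add: mult.assoc)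
  have step: "(hi - lo) / 2 ^ Suc m = (hi - t) / 2 ^ m" "(hi - lo) / 2 ^ Suc m = (t - lo) / 2 ^ m"
    by (auto simp: t_def field_simps)
  show ?case
    unfolding bsearch.simps outcome_ok.simps t_def[symmetric]
  proof (intro conjI allI impI q)
    fix b
    assume b: "mem_answer_ok n K \<delta> (\<lambda>i. z i / t) b"
    show "outcome_ok n (mem_answer_ok n K \<delta>)
            (\<lambda>r. \<bar>r - minkowski K z\<bar> \<le> (hi - lo) / 2 ^ Suc m + T * \<kappa> * \<delta>)
            (if b then bsearch m z lo t else bsearch m z t hi)"
    proof (cases b)
      case True
      then have "minkowski K (\<lambda>i. z i / t) \<le> 1 + \<kappa> * \<delta>"
        using mem_answer_minkowski[OF b q] by simp
      then have "minkowski K z \<le> t + t * (\<kappa> * \<delta>)"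
        using t mult_left_mono[of "minkowski K (\<lambda>i. z i / t)" "1 + \<kappa> * \<delta>" t]
        by (simp add: z distrib_left)
      then show ?thesis
        using Suc.IH[of lo t] Suc.prems t err True by (simp only: step(2) if_True)
    next
      case False
      then have "minkowski K (\<lambda>i. z i / t) \<ge> 1 - \<kappa> * \<delta>"
        using mem_answer_minkowski[OF b q] by simp
      then have "minkowski K z \<ge> t - t * (\<kappa> * \<delta>)"
        using t mult_left_mono[of "1 - \<kappa> * \<delta>" "minkowski K (\<lambda>i. z i / t)" t]
        by (simp add: z right_diff_distrib)
      then show ?thesis
        using Suc.IH[of t hi] Suc.prems t err False by (simp only: step(1) if_False)
    qed
  qed
qed


section \<open>Collecting several estimates\<close>

primrec tabulate :: "nat \<Rightarrow> (nat \<Rightarrow> real alg) \<Rightarrow> (nat \<Rightarrow> real) alg"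
  where
    "tabulate 0 E = Return (\<lambda>_. 0)"
  | "tabulate (Suc k) E = bind_alg (tabulate k E) (\<lambda>v. bind_alg (E k) (\<lambda>r. Return (v(k := r))))"

lemma tabulate_ok:
  assumes "\<And>i. i < k \<Longrightarrow> outcome_ok n ok (Q i) (E i)"
  shows "outcome_ok n ok (\<lambda>v. \<forall>i<k. Q i (v i)) (tabulate k E)"
  using assms
proof (induction k)
  case (Suc k)
  have "outcome_ok n ok (\<lambda>v. \<forall>i<k. Q i (v i)) (tabulate k E)"
    using Suc by simp
  then show ?case
    unfolding tabulate.simps
    by (rule outcome_ok_bind) (rule outcome_ok_bind[OF Suc.prems], auto simp: less_Suc_eq)
qed simp

lemma calls_tabulate:
  assumes "\<And>i. i < k \<Longrightarrow> calls (E i) \<le> enat m"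
  shows "calls (tabulate k E) \<le> enat (k * m)"
  using assms
proof (induction k)
  case 0
  then show ?case by (simp add: zero_enat_def)
next
  case (Suc k)
  have "calls (bind_alg (E k) (\<lambda>r. Return (v(k := r)))) \<le> enat (m + 0)" for v
    by (rule calls_bind_le) (use Suc.prems in \<open>auto simp: zero_enat_def\<close>)
  then have "calls (tabulate (Suc k) E) \<le> enat (k * m + m)"
    unfolding tabulate.simps using Suc by (intro calls_bind_le) auto
  then show ?case by (simp add: add.commute)
qed


section \<open>Finite differences on a random grid\<close>

definition second_difference :: "((nat \<Rightarrow> real) \<Rightarrow> real) \<Rightarrow> real \<Rightarrow> (nat \<Rightarrow> real) \<Rightarrow> nat \<Rightarrow> real"
  where "second_difference f h z i = f (z(i := z i + h)) - 2 * f z + f (z(i := z i - h))"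

lemma fun_upd_Rn: "z \<in> Rn n \<Longrightarrow> i < n \<Longrightarrow> z(i := a) \<in> Rn n"
  by (auto simp: Rn_iff)

lemma norm2_upd_diff: "norm2 n (\<lambda>j. (v(i := a)) j - (v(i := b)) j) \<le> \<bar>a - b\<bar>"
proof -
  have "norm2 n (\<lambda>j. (v(i := a)) j - (v(i := b)) j) \<le> (\<Sum>j<n. if j = i then \<bar>a - b\<bar> else 0)"
    by (rule order_trans[OF norm2_le_sum], rule sum_mono) auto
  then show ?thesis by (auto simp: sum.delta split: if_splits)
qed

context round_body
begin

lemma minkowski_upd_le:
  assumes "v \<in> Rn n" "i < n"
  shows "minkowski K (v(i := a)) \<le> minkowski K (v(i := b)) + \<kappa> * \<bar>a - b\<bar>"
  using minkowski_Lipschitz[OF fun_upd_Rn[OF assms, of a] fun_upd_Rn[OF assms, of b]]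
    mult_left_mono[OF norm2_upd_diff[of n v i a b], of \<kappa>] \<kappa>
  by linarith

lemma second_difference_nonneg:
  assumes "z \<in> Rn n" "i < n"
  shows "second_difference (minkowski K) h z i \<ge> 0"
proof -
  have "2 * minkowski K z = minkowski K (\<lambda>j. 2 * z j)"
    using minkowski_scale[OF assms(1), of 2] by simp
  also have "(\<lambda>j. 2 * z j) = (\<lambda>j. (z(i := z i + h)) j + (z(i := z i - h)) j)"
    by auto
  also have "minkowski K \<dots> \<le> minkowski K (z(i := z i + h)) + minkowski K (z(i := z i - h))"
    using assms by (intro minkowski_add fun_upd_Rn)
  finally show ?thesis by (simp add: second_difference_def)
qed

text \<open>
  With b_i = |x_i - z_i| / h, the vector (1 + sum b_i) z is x plus the b-weighted sum of those
  neighbours of z on the coordinate axes that lie on the side opposite to x. Sublinearity of the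
  gauge then replaces the existence of a subgradient at z.
\<close>

lemma forward_difference_subgradient:
  assumes x: "x \<in> Rn n" and z: "z \<in> Rn n" and h: "h > 0"
  shows "minkowski K z + (\<Sum>i<n. (minkowski K (z(i := z i + h)) - minkowski K z) / h * (x i - z i))
      - (\<Sum>i<n. \<bar>x i - z i\<bar> / h * second_difference (minkowski K) h z i) \<le> minkowski K x"
proof -
  define b where "b i = \<bar>x i - z i\<bar> / h" for i
  \<comment> \<open>For x i = z i the sign is 0, which gives w i = z with weight b i = 0.\<close>
  define w where "w i = z(i := z i - sgn (x i - z i) * h)" for i
  have b: "b i \<ge> 0" for i
    using h by (simp add: b_def)
  have w: "w i \<in> Rn n" if "i < n" for i
    using z that by (auto simp: w_def Rn_iff)
  have comb: "(1 + (\<Sum>i<n. b i)) * z k = x k + (\<Sum>i<n. b i * w i k)" for k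
  proof (cases "k < n")
    case True
    have "(\<Sum>i<n. b i * w i k) = (\<Sum>i<n. b i * z k - (if i = k then x k - z k else 0))"
    proof (rule sum.cong)
      fix i
      have "b i * (sgn (x i - z i) * h) = x i - z i"
        using h by (simp add: b_def abs_mult_sgn)
      then show "b i * w i k = b i * z k - (if i = k then x k - z k else 0)"
        by (auto simp: w_def right_diff_distrib)
    qed simp
    also have "\<dots> = (\<Sum>i<n. b i) * z k - (x k - z k)"
      using True by (simp add: sum_subtractf sum.delta sum_distrib_right)
    finally show ?thesis by (simp add: algebra_simps)
  next
    case False
    then have "w i k = 0" if "i < n" for i
      using w[OF that] by (auto simp: Rn_iff)
    then show ?thesis using x z False by (simp add: Rn_iff)
  qed
  have "(1 + (\<Sum>i<n. b i)) * minkowski K z = minkowski K (\<lambda>k. (1 + (\<Sum>i<n. b i)) * z k)"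
    using z b sum_nonneg[of "{..<n}" b] by (intro minkowski_scale[symmetric]) auto
  also have "\<dots> = minkowski K (\<lambda>k. x k + (\<Sum>i<n. b i * w i k))"
    by (simp only: comb)
  also have "\<dots> \<le> minkowski K x + minkowski K (\<lambda>k. \<Sum>i<n. b i * w i k)"
    using w by (intro minkowski_add x) (auto simp: Rn_iff)
  also have "minkowski K (\<lambda>k. \<Sum>i<n. b i * w i k) \<le> (\<Sum>i<n. minkowski K (\<lambda>k. b i * w i k))"
    using w by (intro minkowski_sum) (auto simp: Rn_iff)
  also have "\<dots> = (\<Sum>i<n. b i * minkowski K (w i))"
    using w b by (intro sum.cong minkowski_scale) auto
  finally have "minkowski K z - minkowski K x \<le> (\<Sum>i<n. b i * (minkowski K (w i) - minkowski K z))"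
    by (simp add: algebra_simps sum_subtractf sum_distrib_left)
  also have "\<dots> \<le> (\<Sum>i<n. \<bar>x i - z i\<bar> / h * second_difference (minkowski K) h z i
      - (minkowski K (z(i := z i + h)) - minkowski K z) / h * (x i - z i))"
  proof (rule sum_mono)
    fix i
    assume "i \<in> {..<n}"
    then have D: "second_difference (minkowski K) h z i \<ge> 0"
      using second_difference_nonneg[OF z] by simp
    \<comment> \<open>If x i > z i, then w i is the backward neighbour, and the second difference
      trades its slope exactly for the forward one. If x i < z i, then w i is the forward neighbour
      itself, and the second difference is nonnegative slack.\<close>
    consider "x i = z i" | "x i > z i" | "x i < z i" by linarith
    then show "b i * (minkowski K (w i) - minkowski K z)
      \<le> \<bar>x i - z i\<bar> / h * second_difference (minkowski K) h z i
        - (minkowski K (z(i := z i + h)) - minkowski K z) / h * (x i - z i)"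
    proof cases
      case 1
      then show ?thesis by (simp add: b_def)
    next
      case 2
      then show ?thesis using h
        by (simp add: b_def w_def second_difference_def field_simps)
    next
      case 3
      have "0 \<le> (z i - x i) / h * second_difference (minkowski K) h z i"
        using D h 3 by simp
      moreover have "b i * (minkowski K (w i) - minkowski K z)
          = - ((minkowski K (z(i := z i + h)) - minkowski K z) / h * (x i - z i))"
        using h 3 by (simp add: b_def w_def field_simps)
      ultimately show ?thesis using 3 by simp
    qed
  qed
  finally show ?thesis by (simp add: sum_subtractf)
qed

end


section \<open>Averaging second differences over a grid\<close>

text \<open>\<open>PiE\<close> fixes the values from n on, which makes the set finite and gives it a
  uniform distribution.\<close>

definition grid :: "nat \<Rightarrow> nat \<Rightarrow> (nat \<Rightarrow> nat) set"
  where "grid n M = PiE {..<n} (\<lambda>_. {..<M})"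

text \<open>The guard is needed because elements of \<^term>\<open>grid n M\<close> are \<^term>\<open>undefined\<close> from n on.\<close>

definition grid_point :: "nat \<Rightarrow> (nat \<Rightarrow> real) \<Rightarrow> real \<Rightarrow> (nat \<Rightarrow> nat) \<Rightarrow> nat \<Rightarrow> real"
  where "grid_point n y h k = (\<lambda>i. if i < n then y i + h * real (k i) else 0)"

lemma finite_grid: "finite (grid n M)"
  by (auto simp: grid_def intro: finite_PiE)

lemma grid_nonempty: "M > 0 \<Longrightarrow> grid n M \<noteq> {}"
  by (auto simp: grid_def PiE_eq_empty_iff)

lemma grid_point_Rn: "grid_point n y h k \<in> Rn n"
  by (simp add: Rn_iff grid_point_def)

lemma norm2_grid_point_diff:
  assumes "k \<in> grid n M" "h \<ge> 0"
  shows "norm2 n (\<lambda>i. grid_point n y h k i - y i) \<le> real n * (h * real M)"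
proof -
  have "norm2 n (\<lambda>i. grid_point n y h k i - y i) \<le> (\<Sum>i<n. h * real M)"
  proof (rule order_trans[OF norm2_le_sum], rule sum_mono)
    fix i
    assume "i \<in> {..<n}"
    then have "k i < M" "i < n" using assms(1) by (auto simp: grid_def)
    then show "\<bar>grid_point n y h k i - y i\<bar> \<le> h * real M"
      using assms(2) by (auto simp: grid_point_def intro: mult_left_mono)
  qed
  then show ?thesis by simp
qed

text \<open>Each summand is an increment of the first difference f(j) - f(j - 1).\<close>

lemma sum_second_difference_telescope:
  fixes f :: "real \<Rightarrow> real"
  shows "(\<Sum>j<M. f (real j + 1) - 2 * f (real j) + f (real j - 1))
    = (f (real M) - f (real M - 1)) - (f 0 - f (-1))"
  by (induction M) (auto simp: add.commute)

context round_body
begin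

text \<open>The grid splits into lines of M points parallel to axis i. On each line telescoping
  leaves two first differences, each bounded by \<kappa> h.\<close>

lemma sum_grid_second_difference_le:
  assumes i: "i < n" and "h \<ge> 0"
  shows "real M * (\<Sum>k\<in>grid n M. second_difference (minkowski K) h (grid_point n y h k) i)
    \<le> 2 * \<kappa> * h * real (card (grid n M))"
proof -
  define I where "I = {..<n} - {i}"
  define R where "R = PiE I (\<lambda>_. {..<M})"
  have insert: "insert i I = {..<n}" and notin: "i \<notin> I" and "finite I"
    using i by (auto simp: I_def)
  have grid: "grid n M = (\<lambda>(j, g). g(i := j)) ` ({..<M} \<times> R)"
    unfolding grid_def R_def insert[symmetric] by (rule PiE_insert_eq)
  have inj: "inj_on (\<lambda>(j, g). g(i := j)) ({..<M} \<times> R)"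
    unfolding R_def by (rule inj_combinator[OF notin])
  \<comment> \<open>The gauge along the line through g. The parameter t is real so as to cover the
    neighbours at -1 and M, just outside the grid; coordinate i of g is overwritten.\<close>
  define \<phi> where "\<phi> g t = minkowski K ((grid_point n y h g)(i := y i + h * t))" for g t
  have line: "second_difference (minkowski K) h (grid_point n y h (g(i := j))) i
      = \<phi> g (real j + 1) - 2 * \<phi> g (real j) + \<phi> g (real j - 1)" for g j
  proof -
    have 1: "grid_point n y h (g(i := j)) = (grid_point n y h g)(i := y i + h * real j)"
      using i by (auto simp: grid_point_def)
    show ?thesis
      unfolding second_difference_def 1 \<phi>_def by (simp add: algebra_simps)
  qed
  have Lip: "\<phi> g s \<le> \<phi> g t + \<kappa> * h" if "\<bar>s - t\<bar> = 1" for g s t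
  proof -
    have "y i + h * s - (y i + h * t) = h * (s - t)"
      by (simp add: algebra_simps)
    then show ?thesis
      using minkowski_upd_le[OF grid_point_Rn i, of y h g "y i + h * s" "y i + h * t"] that \<open>h \<ge> 0\<close>
      by (simp add: \<phi>_def abs_mult)
  qed
  have "(\<Sum>k\<in>grid n M. second_difference (minkowski K) h (grid_point n y h k) i)
      = (\<Sum>(j, g)\<in>{..<M} \<times> R. \<phi> g (real j + 1) - 2 * \<phi> g (real j) + \<phi> g (real j - 1))"
    unfolding grid by (subst sum.reindex[OF inj]) (simp add: case_prod_unfold line comp_def)
  also have "\<dots> = (\<Sum>g\<in>R. \<Sum>j<M. \<phi> g (real j + 1) - 2 * \<phi> g (real j) + \<phi> g (real j - 1))"
    by (subst sum.swap) (simp add: sum.cartesian_product)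
  also have "\<dots> \<le> (\<Sum>g\<in>R. 2 * \<kappa> * h)"
  proof (rule sum_mono)
    fix g
    show "(\<Sum>j<M. \<phi> g (real j + 1) - 2 * \<phi> g (real j) + \<phi> g (real j - 1)) \<le> 2 * \<kappa> * h"
      unfolding sum_second_difference_telescope
      using Lip[of "real M" "real M - 1" g] Lip[of "-1" 0 g] by simp
  qed
  finally have "real M * (\<Sum>k\<in>grid n M. second_difference (minkowski K) h (grid_point n y h k) i)
      \<le> real M * (\<Sum>g\<in>R. 2 * \<kappa> * h)"
    by (rule mult_left_mono) simp
  also have "\<dots> = 2 * \<kappa> * h * real (card (grid n M))"
    unfolding grid by (simp add: card_image[OF inj] card_cartesian_product)
  finally show ?thesis .
qed

text \<open>Markov's inequality in counting form, for a sum whose mean is at most 2 \<kappa> h n /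
  M.\<close>

lemma prob_grid_second_difference:
  assumes "h > 0" "M > 0" "\<theta> > 0"
  shows "measure_pmf.prob (pmf_of_set (grid n M))
      {k. (\<Sum>i<n. second_difference (minkowski K) h (grid_point n y h k) i) \<le> \<theta>}
    \<ge> 1 - 2 * \<kappa> * h * real n / (real M * \<theta>)"
proof -
  define D where "D k = (\<Sum>i<n. second_difference (minkowski K) h (grid_point n y h k) i)" for k
  let ?G = "grid n M"
  let ?p = "measure_pmf.prob (pmf_of_set ?G)"
  have fin: "?G \<noteq> {}" "finite ?G"
    using grid_nonempty finite_grid assms by auto
  then have card: "real (card ?G) > 0" by (simp add: card_gt_0_iff)
  have D: "D k \<ge> 0" for k
    unfolding D_def by (intro sum_nonneg second_difference_nonneg grid_point_Rn) auto
  have "real M * (\<theta> * real (card {k \<in> ?G. D k > \<theta>})) \<le> real M * (\<Sum>k\<in>?G. D k)"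
  proof (rule mult_left_mono)
    have "\<theta> * real (card {k \<in> ?G. D k > \<theta>}) = (\<Sum>k\<in>{k \<in> ?G. D k > \<theta>}. \<theta>)"
      by simp
    also have "\<dots> \<le> (\<Sum>k\<in>{k \<in> ?G. D k > \<theta>}. D k)"
      by (rule sum_mono) auto
    also have "\<dots> \<le> (\<Sum>k\<in>?G. D k)"
      using D fin by (intro sum_mono2) auto
    finally show "\<theta> * real (card {k \<in> ?G. D k > \<theta>}) \<le> (\<Sum>k\<in>?G. D k)" .
  qed simp
  also have "\<dots> = (\<Sum>i<n. real M *
      (\<Sum>k\<in>?G. second_difference (minkowski K) h (grid_point n y h k) i))"
    unfolding D_def by (subst sum.swap) (simp add: sum_distrib_left)
  also have "\<dots> \<le> (\<Sum>i<n. 2 * \<kappa> * h * real (card ?G))"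
    using assms by (intro sum_mono sum_grid_second_difference_le) auto
  finally have bad: "real (card {k \<in> ?G. D k > \<theta>}) / real (card ?G)
      \<le> 2 * \<kappa> * h * real n / (real M * \<theta>)"
    using assms card by (simp add: field_simps)
  have "?p {k. D k > \<theta>} = real (card {k \<in> ?G. D k > \<theta>}) / real (card ?G)"
    using fin by (simp add: measure_pmf_of_set Int_def)
  moreover have "?p {k. D k \<le> \<theta>} = 1 - ?p {k. D k > \<theta>}"
    using measure_pmf.prob_compl[of "{k. D k > \<theta>}" "pmf_of_set ?G"]
    by (simp add: Compl_eq_Diff_UNIV[symmetric] not_less Collect_neg_eq[symmetric])
  ultimately show ?thesis using bad by (simp add: D_def)
qed

end


section \<open>The separation algorithm\<close>

text \<open>The threshold leaves room on both sides when values have error at most \<eta> / 8 and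
  the gauges of y and z differ by at most \<eta> / 4: below it the gauge of y is under 1 + \<eta>,
  above it the gauge of z is at least 1.\<close>

definition local_sep ::
    "nat \<Rightarrow> nat \<Rightarrow> real \<Rightarrow> real \<Rightarrow> real \<Rightarrow> (nat \<Rightarrow> real) \<Rightarrow> sep_answer alg"
  where "local_sep n m T h \<eta> z =
    bind_alg (bsearch m z 0 T) (\<lambda>r.
      if r < 1 + \<eta> / 2 then Return Inside
      else bind_alg (tabulate n (\<lambda>i. bsearch m (z(i := z i + h)) 0 T)) (\<lambda>v.
        let g = (\<lambda>i. if i < n then (v i - r) / h else 0)
        in Return (Separator (\<lambda>i. g i / norm2 n g))))"

text \<open>Coins are natural numbers, hence the encoding of the grid. Outside the unit ball y is
  its own separator; inside, all evaluated points stay bounded.\<close>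

definition sep_alg ::
    "nat \<Rightarrow> nat \<Rightarrow> nat \<Rightarrow> real \<Rightarrow> real \<Rightarrow> real \<Rightarrow> (nat \<Rightarrow> real) \<Rightarrow> sep_answer alg"
  where "sep_alg n m M T h \<eta> y =
    (if norm2 n y > 1 then Return (Separator (\<lambda>i. y i / norm2 n y))
     else Sample (map_pmf (to_nat_on (grid n M)) (pmf_of_set (grid n M)))
       (\<lambda>j. local_sep n m T h \<eta> (grid_point n y h (from_nat_into (grid n M) j))))"

lemma calls_local_sep: "calls (local_sep n m T h \<eta> z) \<le> enat ((n + 1) * m)"
proof -
  have "calls (tabulate n (\<lambda>i. bsearch m (z(i := z i + h)) 0 T)) \<le> enat (n * m)"
    by (rule calls_tabulate) (simp add: calls_bsearch)
  then have "calls (bind_alg (tabulate n (\<lambda>i. bsearch m (z(i := z i + h)) 0 T)) (\<lambda>v. Return (f v)))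
      \<le> enat (n * m + 0)" for f :: "(nat \<Rightarrow> real) \<Rightarrow> sep_answer"
    by (rule calls_bind_le) (simp add: zero_enat_def)
  then have "calls (local_sep n m T h \<eta> z) \<le> enat (m + n * m)"
    unfolding local_sep_def Let_def by (intro calls_bind_le) (auto simp: calls_bsearch)
  then show ?thesis by simp
qed

lemma calls_sep_alg: "calls (sep_alg n m M T h \<eta> y) \<le> enat ((n + 1) * m)"
  using calls_local_sep[of n m T h \<eta>] by (auto simp: sep_alg_def intro!: SUP_least)

section \<open>Correctness of the separation algorithm\<close>

context round_body
begin

text \<open>By Cauchy-Schwarz c . x \<le> 1 on K, while c . y is the norm of y.\<close>

lemma separator_outside_ball:
  assumes "y \<in> Rn n" "norm2 n y > 1" "\<eta> \<ge> 0"
  shows "sep_answer_ok n K \<eta> y (Separator (\<lambda>i. y i / norm2 n y))"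
proof -
  let ?c = "\<lambda>i. y i / norm2 n y"
  have c: "norm2 n ?c = 1"
    using assms by (simp add: norm2_divide)
  have "inner2 n ?c x \<le> inner2 n ?c y + \<eta>" if "x \<in> inner_core n K \<eta>" for x
  proof -
    have "x \<in> K"
      using that inner_core_subset assms by blast
    then have "inner2 n ?c x \<le> 1"
      using inner2_le[of n ?c x] norm_le_1[of x] c by simp
    moreover have "inner2 n ?c y = norm2 n y"
    proof -
      have "inner2 n ?c y = (norm2 n y)\<^sup>2 / norm2 n y"
        by (simp add: inner2_def norm2_def L2_set_def sum_nonneg power2_eq_square
            sum_divide_distrib)
      then show ?thesis by (simp add: power2_eq_square)
    qed
    ultimately show ?thesis using assms by linarith
  qed
  then show ?thesis using assms c by (auto simp: Rn_iff)
qed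

text \<open>The norm bounds 1 and 2 give coordinate distances at most 3. Two estimates enter each
  slope, so it is off by at most 2 \<epsilon> / h; this yields the factors 3 and 6.\<close>

lemma approximate_gradient:
  assumes x: "x \<in> Rn n" "norm2 n x \<le> 1" and z: "z \<in> Rn n" "norm2 n z \<le> 2" and h: "h > 0"
    and D: "(\<Sum>i<n. second_difference (minkowski K) h z i) \<le> \<theta>"
    and r: "\<bar>r - minkowski K z\<bar> \<le> \<epsilon>"
    and v: "\<And>i. i < n \<Longrightarrow> \<bar>v i - minkowski K (z(i := z i + h))\<bar> \<le> \<epsilon>"
  shows "(\<Sum>i<n. (v i - r) / h * (x i - z i))
    \<le> minkowski K x - minkowski K z + 3 * \<theta> / h + 6 * real n * \<epsilon> / h"
proof -
  define F where "F i = (minkowski K (z(i := z i + h)) - minkowski K z) / h" for i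
  define D where "D i = second_difference (minkowski K) h z i" for i
  have dist: "\<bar>x i - z i\<bar> \<le> 3" if "i < n" for i
    using abs_le_norm2[OF that, of x] abs_le_norm2[OF that, of z] x z by linarith
  have "(\<Sum>i<n. (v i - r) / h * (x i - z i)) \<le> (\<Sum>i<n. F i * (x i - z i) + 6 * \<epsilon> / h)"
  proof (rule sum_mono)
    fix i
    assume "i \<in> {..<n}"
    then have i: "i < n" by simp
    have "\<bar>(v i - r) / h - F i\<bar> = \<bar>(v i - minkowski K (z(i := z i + h))) - (r - minkowski K z)\<bar> / h"
      using h by (simp add: F_def diff_divide_distrib[symmetric] abs_divide algebra_simps)
    also have "\<dots> \<le> 2 * \<epsilon> / h"
      using v[OF i] r h by (intro divide_right_mono) auto
    finally have "\<bar>(v i - r) / h - F i\<bar> * \<bar>x i - z i\<bar> \<le> 2 * \<epsilon> / h * 3"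
      using dist[OF i] by (intro mult_mono) auto
    then have "((v i - r) / h - F i) * (x i - z i) \<le> 6 * \<epsilon> / h"
      by (simp flip: abs_mult)
    then show "(v i - r) / h * (x i - z i) \<le> F i * (x i - z i) + 6 * \<epsilon> / h"
      by (simp add: algebra_simps)
  qed
  also have "\<dots> = (\<Sum>i<n. F i * (x i - z i)) + 6 * real n * \<epsilon> / h"
    by (simp add: sum.distrib)
  also have "(\<Sum>i<n. F i * (x i - z i))
      \<le> minkowski K x - minkowski K z + (\<Sum>i<n. \<bar>x i - z i\<bar> / h * D i)"
    using forward_difference_subgradient[OF x(1) z(1) h] by (simp add: F_def D_def)
  also have "(\<Sum>i<n. \<bar>x i - z i\<bar> / h * D i) \<le> (\<Sum>i<n. 3 / h * D i)"
    using dist h second_difference_nonneg[OF z(1)]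
    by (intro sum_mono mult_right_mono divide_right_mono) (auto simp: D_def)
  also have "\<dots> = 3 / h * (\<Sum>i<n. D i)"
    by (simp add: sum_distrib_left)
  also have "\<dots> \<le> 3 / h * \<theta>"
    using assms(6) h by (intro mult_left_mono) (auto simp: D_def)
  finally show ?thesis by simp
qed

text \<open>Shrinking y radially by the factor 1 + \<eta> moves it into K over a distance at most
  \<eta>.\<close>

lemma mem_outer_of_minkowski:
  assumes "y \<in> Rn n" "norm2 n y \<le> 1" "\<eta> > 0" "minkowski K y < 1 + \<eta>"
  shows "y \<in> outer n K \<eta>"
  unfolding outer_def
proof (intro CollectI conjI bexI)
  show "(\<lambda>i. y i / (1 + \<eta>)) \<in> K"
    using assms by (intro divide_mem_of_minkowski_less)
  have "norm2 n (\<lambda>i. y i - y i / (1 + \<eta>)) = norm2 n (\<lambda>i. \<eta> / (1 + \<eta>) * y i)"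
    using assms(3) by (intro arg_cong[where f = "norm2 n"]) (auto simp: field_simps)
  also have "\<dots> \<le> \<eta> / (1 + \<eta>) * 1"
    unfolding norm2_scale using assms by (intro mult_mono) auto
  also have "\<dots> \<le> \<eta>"
    using assms(3) by (simp add: field_simps)
  finally show "norm2 n (\<lambda>i. y i - y i / (1 + \<eta>)) \<le> \<eta>" .
qed (use assms in auto)

text \<open>The test point 0 gives g . z \<ge> 1 / 2, so g has norm at least 1 / 4. Normalizing then
  enlarges the error \<eta> / 8 to at most \<eta> / 2, and passing from z to y adds \<eta> /
  4.\<close>

lemma separator_of_approximate_gradient:
  assumes y: "y \<in> Rn n" "norm2 n y \<le> 1"
    and z: "z \<in> Rn n" "norm2 n (\<lambda>i. z i - y i) \<le> \<eta> / 4"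
    and \<eta>: "0 < \<eta>" "\<eta> < 1 / 2"
    and gz: "minkowski K z \<ge> 1" and g_Rn: "g \<in> Rn n"
    and g: "\<And>x. x \<in> Rn n \<Longrightarrow> norm2 n x \<le> 1 \<Longrightarrow>
      (\<Sum>i<n. g i * (x i - z i)) \<le> minkowski K x - minkowski K z + \<eta> / 8"
  shows "sep_answer_ok n K \<eta> y (Separator (\<lambda>i. g i / norm2 n g))"
proof -
  have zero: "(\<lambda>_. 0) \<in> Rn n" "norm2 n (\<lambda>_. 0) \<le> 1"
    by (auto simp: Rn_iff norm2_def L2_set_def)
  have "norm2 n z \<le> 2"
    using norm2_le_add_diff[of n z y] y z \<eta> by linarith
  have "1 / 2 \<le> inner2 n g z"
    using g[OF zero] gz \<eta> by (simp add: minkowski_zero inner2_def sum_negf)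
  also have "\<dots> \<le> norm2 n g * norm2 n z"
    by (rule inner2_le)
  also have "\<dots> \<le> norm2 n g * 2"
    using \<open>norm2 n z \<le> 2\<close> by (intro mult_left_mono) auto
  finally have norm_g: "norm2 n g \<ge> 1 / 4" by simp
  let ?c = "\<lambda>i. g i / norm2 n g"
  have c: "norm2 n ?c = 1"
    using norm_g by (simp add: norm2_divide)
  have "inner2 n ?c x \<le> inner2 n ?c y + \<eta>" if "x \<in> inner_core n K \<eta>" for x
  proof -
    have x: "x \<in> K"
      using that inner_core_subset[of \<eta> n K] \<eta> by auto
    have "(\<Sum>i<n. g i * (x i - z i)) \<le> \<eta> / 8"
      using g[OF K_Rn[OF x] norm_le_1[OF x]] minkowski_le_1[OF x] gz by linarith
    then have "(\<Sum>i<n. g i * (x i - z i)) / norm2 n g \<le> (\<eta> / 8) / (1 / 4)"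
      using norm_g \<eta> by (intro frac_le) auto
    moreover have "(\<Sum>i<n. g i * (x i - z i)) / norm2 n g = inner2 n ?c x - inner2 n ?c z"
      by (simp add: inner2_def sum_divide_distrib sum_subtractf right_diff_distrib
          diff_divide_distrib)
    moreover have "inner2 n ?c z - inner2 n ?c y = inner2 n ?c (\<lambda>i. z i - y i)"
      by (simp add: inner2_def sum_subtractf right_diff_distrib)
    moreover have "inner2 n ?c (\<lambda>i. z i - y i) \<le> \<eta> / 4"
      using inner2_le[of n ?c "\<lambda>i. z i - y i"] z(2) c by simp
    ultimately show ?thesis using \<eta> by simp
  qed
  then show ?thesis using c g_Rn by (auto simp: Rn_iff)
qed

lemma local_sep_ok:
  assumes y: "y \<in> Rn n" "norm2 n y \<le> 1"
    and z: "z \<in> Rn n" "\<kappa> * norm2 n (\<lambda>i. z i - y i) \<le> \<eta> / 4"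
    and \<eta>: "0 < \<eta>" "\<eta> < 1 / 2" and h: "0 < h" "h \<le> 1 / 2"
    and D: "(\<Sum>i<n. second_difference (minkowski K) h z i) \<le> \<theta>"
    and T: "2 * \<kappa> \<le> T" and \<delta>: "\<delta> \<ge> 0"
    and \<epsilon>: "T / 2 ^ m + T * \<kappa> * \<delta> \<le> \<epsilon>" "\<epsilon> \<le> \<eta> / 8"
    and err: "3 * \<theta> / h + 6 * real n * \<epsilon> / h \<le> \<eta> / 8"
  shows "outcome_ok n (mem_answer_ok n K \<delta>) (sep_answer_ok n K \<eta> y) (local_sep n m T h \<eta> z)"
proof -
  have "1 * norm2 n (\<lambda>i. z i - y i) \<le> \<kappa> * norm2 n (\<lambda>i. z i - y i)"
    using \<kappa> by (intro mult_right_mono) auto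
  then have dist: "norm2 n (\<lambda>i. z i - y i) \<le> \<eta> / 4"
    using z by linarith
  then have norm_z: "norm2 n z \<le> 3 / 2"
    using norm2_le_add_diff[of n z y] y \<eta> by linarith
  \<comment> \<open>Radius 2 covers z, of norm at most 3/2, and its neighbours at distance h \<le>
    1/2; there the gauge is at most 2 \<kappa> \<le> T.\<close>
  have search: "outcome_ok n (mem_answer_ok n K \<delta>) (\<lambda>r. \<bar>r - minkowski K u\<bar> \<le> \<epsilon>) (bsearch m u 0 T)"
    if u: "u \<in> Rn n" "norm2 n u \<le> 2" for u
  proof -
    have "\<kappa> * norm2 n u \<le> \<kappa> * 2"
      using u \<kappa> by (intro mult_left_mono) auto
    then have range: "0 \<le> minkowski K u" "minkowski K u \<le> T"
      using minkowski_nonneg minkowski_le_norm[of u] u T by auto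
    have "0 < T" and "0 \<le> T * \<kappa> * \<delta>"
      using T \<kappa> \<delta> by auto
    then have "outcome_ok n (mem_answer_ok n K \<delta>)
        (\<lambda>r. \<bar>r - minkowski K u\<bar> \<le> (T - 0) / 2 ^ m + T * \<kappa> * \<delta>) (bsearch m u 0 T)"
      using range u \<delta> by (intro bsearch_ok) auto
    \<comment> \<open>Composition with \<open>Return\<close> serves as the rule of
      consequence.\<close>
    then have "outcome_ok n (mem_answer_ok n K \<delta>) (\<lambda>r. \<bar>r - minkowski K u\<bar> \<le> \<epsilon>)
        (bind_alg (bsearch m u 0 T) Return)"
      by (rule outcome_ok_bind) (use \<epsilon> in auto)
    moreover have "bind_alg a Return = a" for a :: "real alg"
      by (induction a) auto
    ultimately show ?thesis by simp
  qed
  show ?thesis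
    unfolding local_sep_def
  proof (rule outcome_ok_bind[OF search])
    show "z \<in> Rn n" "norm2 n z \<le> 2"
      using z norm_z by auto
    fix r
    assume r: "\<bar>r - minkowski K z\<bar> \<le> \<epsilon>"
    have "outcome_ok n (mem_answer_ok n K \<delta>) (sep_answer_ok n K \<eta> y) (Return Inside)"
      if "r < 1 + \<eta> / 2"
    proof -
      have "minkowski K y \<le> minkowski K z + \<kappa> * norm2 n (\<lambda>i. z i - y i)"
        using minkowski_Lipschitz[OF y(1) z(1)] by (simp add: norm2_minus_commute[of n y z])
      also have "\<dots> < 1 + \<eta>"
        using z r that \<epsilon> \<eta> by linarith
      finally show ?thesis
        using mem_outer_of_minkowski y \<eta> by simp
    qed
    moreover have "outcome_ok n (mem_answer_ok n K \<delta>) (sep_answer_ok n K \<eta> y)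
        (bind_alg (tabulate n (\<lambda>i. bsearch m (z(i := z i + h)) 0 T)) (\<lambda>v.
          let g = (\<lambda>i. if i < n then (v i - r) / h else 0)
          in Return (Separator (\<lambda>i. g i / norm2 n g))))"
      if "\<not> r < 1 + \<eta> / 2"
    proof (rule outcome_ok_bind[OF tabulate_ok])
      fix i
      assume i: "i < n"
      have "norm2 n (z(i := z i + h)) \<le> norm2 n z + h"
        using norm2_le_add_diff[of n "z(i := z i + h)" z] norm2_upd_diff[of n z i "z i + h" "z i"] h
        by simp
      then show "outcome_ok n (mem_answer_ok n K \<delta>)
          (\<lambda>r. \<bar>r - minkowski K (z(i := z i + h))\<bar> \<le> \<epsilon>) (bsearch m (z(i := z i + h)) 0 T)"
        using i z norm_z h by (intro search fun_upd_Rn) auto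
    next
      fix v
      assume v: "\<forall>i<n. \<bar>v i - minkowski K (z(i := z i + h))\<bar> \<le> \<epsilon>"
      let ?g = "\<lambda>i. if i < n then (v i - r) / h else 0"
      have "sep_answer_ok n K \<eta> y (Separator (\<lambda>i. ?g i / norm2 n ?g))"
      proof (rule separator_of_approximate_gradient[OF y z(1) dist \<eta>])
        show "minkowski K z \<ge> 1"
          using r that \<epsilon> \<eta> by linarith
        show "?g \<in> Rn n" by (simp add: Rn_iff)
        fix x
        assume x: "x \<in> Rn n" "norm2 n x \<le> 1"
        have "(\<Sum>i<n. (v i - r) / h * (x i - z i))
          \<le> minkowski K x - minkowski K z + 3 * \<theta> / h + 6 * real n * \<epsilon> / h"
          by (rule approximate_gradient[OF x z(1) _ h(1) D r]) (use norm_z v in auto)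
        then show "(\<Sum>i<n. ?g i * (x i - z i)) \<le> minkowski K x - minkowski K z + \<eta> / 8"
          using err by simp
      qed
      then show "outcome_ok n (mem_answer_ok n K \<delta>) (sep_answer_ok n K \<eta> y)
          (let g = ?g in Return (Separator (\<lambda>i. g i / norm2 n g)))"
        by (simp add: Let_def)
    qed
    ultimately show "outcome_ok n (mem_answer_ok n K \<delta>) (sep_answer_ok n K \<eta> y)
        (if r < 1 + \<eta> / 2 then Return Inside
         else bind_alg (tabulate n (\<lambda>i. bsearch m (z(i := z i + h)) 0 T)) (\<lambda>v.
          let g = (\<lambda>i. if i < n then (v i - r) / h else 0)
          in Return (Separator (\<lambda>i. g i / norm2 n g))))"
      by simp
  qed
qed

text \<open>The failure budget \<eta> is split evenly between bad grid points and wrong oracle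
  answers.\<close>

lemma sep_alg_correct:
  assumes y: "y \<in> Rn n" and orc: "mem_oracle n K \<delta> orc"
    and \<eta>: "0 < \<eta>" "\<eta> < 1 / 2" and h: "0 < h" "h \<le> 1 / 2" and "M > 0" "\<theta> > 0"
    and grid: "\<kappa> * (real n * (h * real M)) \<le> \<eta> / 4"
    and \<theta>: "2 * \<kappa> * h * real n / (real M * \<theta>) \<le> \<eta> / 2"
    and T: "2 * \<kappa> \<le> T" and \<delta>: "\<delta> \<ge> 0"
    and \<epsilon>: "T / 2 ^ m + T * \<kappa> * \<delta> \<le> \<epsilon>" "\<epsilon> \<le> \<eta> / 8"
    and err: "3 * \<theta> / h + 6 * real n * \<epsilon> / h \<le> \<eta> / 8"
    and union: "real ((n + 1) * m) * \<delta> \<le> \<eta> / 2"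
  shows "measure_pmf.prob (run orc (sep_alg n m M T h \<eta> y) []) {s. sep_answer_ok n K \<eta> y s}
    \<ge> 1 - \<eta>"
proof (cases "norm2 n y > 1")
  case True
  then show ?thesis
    using separator_outside_ball[OF y True, of \<eta>] \<eta> by (simp add: sep_alg_def)
next
  case False
  let ?G = "grid n M"
  let ?D = "\<lambda>k. \<Sum>i<n. second_difference (minkowski K) h (grid_point n y h k) i"
  have fin: "finite ?G" "?G \<noteq> {}"
    using finite_grid grid_nonempty \<open>M > 0\<close> by auto
  have "run orc (sep_alg n m M T h \<eta> y) []
      = bind_pmf (pmf_of_set ?G) (\<lambda>k. run orc (local_sep n m T h \<eta>
          (grid_point n y h (from_nat_into ?G (to_nat_on ?G k)))) [])"
    using False by (simp add: sep_alg_def bind_map_pmf)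
  also have "\<dots> = bind_pmf (pmf_of_set ?G)
      (\<lambda>k. run orc (local_sep n m T h \<eta> (grid_point n y h k)) [])"
    using fin by (intro bind_pmf_cong) (auto simp: from_nat_into_to_nat_on countable_finite)
  finally have run: "run orc (sep_alg n m M T h \<eta> y) [] = \<dots>" .
  have "measure_pmf.prob (bind_pmf (pmf_of_set ?G)
        (\<lambda>k. run orc (local_sep n m T h \<eta> (grid_point n y h k)) []))
        {s. sep_answer_ok n K \<eta> y s} \<ge> 1 - (\<eta> / 2 + \<eta> / 2)"
  proof (rule prob_bind_pmf_ge)
    show "1 - \<eta> / 2 \<le> measure_pmf.prob (pmf_of_set ?G) {k. ?D k \<le> \<theta>}"
      using prob_grid_second_difference[OF h(1) \<open>M > 0\<close> \<open>\<theta> > 0\<close>, of y] \<theta> by linarith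
  next
    fix k
    assume k: "k \<in> {k. ?D k \<le> \<theta>}" "k \<in> set_pmf (pmf_of_set ?G)"
    have "k \<in> ?G" using k fin by simp
    have "\<kappa> * norm2 n (\<lambda>i. grid_point n y h k i - y i) \<le> \<kappa> * (real n * (h * real M))"
      using norm2_grid_point_diff[OF \<open>k \<in> ?G\<close>] h \<kappa> by (intro mult_left_mono) auto
    then have "outcome_ok n (mem_answer_ok n K \<delta>) (sep_answer_ok n K \<eta> y)
        (local_sep n m T h \<eta> (grid_point n y h k))"
      using k False grid
      by (intro local_sep_ok[OF y _ grid_point_Rn _ \<eta> h _ T \<delta> \<epsilon> err]) auto
    then have "measure_pmf.prob (run orc (local_sep n m T h \<eta> (grid_point n y h k)) [])
        {s. sep_answer_ok n K \<eta> y s} \<ge> 1 - real ((n + 1) * m) * \<delta>"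
      by (intro prob_run_ge[OF orc \<delta>] calls_local_sep)
    then show "1 - \<eta> / 2 \<le> measure_pmf.prob
        (run orc (local_sep n m T h \<eta> (grid_point n y h k)) []) {s. sep_answer_ok n K \<eta> y s}"
      using union by linarith
  qed (use \<eta> in auto)
  then show ?thesis by (simp add: run)
qed

end


text \<open>
  All parameters are powers of q = \<eta> / (n \<kappa>): step q^14, about q^-10 grid points per coordinate,
  accuracy q^23 of the gauge values. The exponents are generous so that q < 1/2 absorbs the
  numerical constants.
\<close>

lemma sep_cost_le:
  assumes n: "n \<ge> 1" and \<kappa>: "\<kappa> \<ge> 1" and \<eta>: "0 < \<eta>" "\<eta> < 1 / 2"
  shows "\<exists>N. sep_cost n
      {K. convex_Rn n K \<and> ball2 n (\<lambda>_. 0) (1 / \<kappa>) \<subseteq> K \<and> K \<subseteq> ball2 n (\<lambda>_. 0) 1}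
      \<eta> ((\<eta> / (real n * \<kappa>)) ^ 26) \<le> enat N
    \<and> real N \<le> 104 * real n * ln (real n * \<kappa> / \<eta>)"
proof -
  define X where "X = real n * \<kappa> / \<eta>"
  define q where "q = \<eta> / (real n * \<kappa>)"
  have n1: "real n \<ge> 1" and n\<kappa>: "real n * \<kappa> \<ge> 1"
    using n \<kappa> mult_mono[of 1 "real n" 1 \<kappa>] by auto
  have q: "q > 0" "q \<le> \<eta>" "q < 1 / 2"
  proof -
    show "q > 0" using n\<kappa> \<eta> by (auto simp: q_def intro!: divide_pos_pos)
    show "q \<le> \<eta>" using n\<kappa> \<eta> by (simp add: q_def divide_le_eq mult_le_cancel_left1)
    then show "q < 1 / 2" using \<eta> by simp
  qed
  have n\<kappa>q: "real n * \<kappa> * q = \<eta>"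
    using n\<kappa> by (auto simp: q_def)
  have X: "X = 1 / q" "X * q = 1" "X > 2"
  proof -
    show inv: "X = 1 / q" by (simp add: X_def q_def)
    show "X * q = 1" "X > 2" using q by (auto simp: inv field_simps)
  qed
  have \<kappa>q: "\<kappa> * q \<le> \<eta>"
    using n\<kappa>q mult_right_mono[OF n1, of "\<kappa> * q"] \<kappa> q by (simp add: mult.assoc)
  have nq: "real n * q \<le> \<eta>"
    using n\<kappa>q mult_left_mono[OF \<kappa>, of "real n * q"] q by (simp add: mult_ac)
  \<comment> \<open>Surplus powers of q are turned into numerical factors 1/2.\<close>
  have pow: "q ^ (a + b) \<le> q ^ a * (1 / 2) ^ b" for a b
    unfolding power_add using q by (intro mult_left_mono power_mono) auto
  \<comment> \<open>Rounding up costs less than a factor X, so M lies between q^-10 and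
    q^-11.\<close>
  define M where "M = nat \<lceil>X ^ 10\<rceil>"
  have "X ^ 10 \<ge> 1"
    using X(3) by (intro one_le_power) auto
  then have M: "X ^ 10 \<le> real M" "real M \<le> X ^ 10 + 1" "M > 0"
    unfolding M_def by linarith+
  have Mq: "1 \<le> real M * q ^ 10"
    using mult_right_mono[OF M(1), of "q ^ 10"] q X(2) by (simp flip: power_mult_distrib)
  have "real M \<le> X ^ 10 * X"
    using M(2) \<open>X ^ 10 \<ge> 1\<close> mult_left_mono[of 2 X "X ^ 10"] X(3) by linarith
  then have Mq': "real M * q ^ 11 \<le> 1"
    using mult_right_mono[of "real M" "X ^ 11" "q ^ 11"] q X(2)
    by (simp flip: power_mult_distrib power_Suc2)
  define h where "h = q ^ 14"
  \<comment> \<open>Chosen to make the Markov bound exactly \<eta> / 2.\<close>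
  define \<theta> where "\<theta> = 4 * \<kappa> * h * real n / (real M * \<eta>)"
  \<comment> \<open>This many halvings shrink the initial interval, of length X = 1 / q, to at most
    q^24.\<close>
  define m where "m = nat \<lceil>25 * log 2 X\<rceil>"
  have log: "log 2 X \<ge> 1"
    using X(3) by simp
  have m: "25 * log 2 X \<le> real m" "real m \<le> 26 * log 2 X"
    using log unfolding m_def by linarith+
  have "X ^ 25 = 2 powr (25 * log 2 X)"
    using X(3) powr_powr[of 2 "log 2 X" 25] by (simp add: mult.commute powr_numeral)
  also have "\<dots> \<le> 2 powr real m"
    using m by simp
  also have "\<dots> = 2 ^ m"
    by (simp add: powr_realpow)
  finally have Xm: "X ^ 25 \<le> 2 ^ m" .
  \<comment> \<open>Since ln 2 \<ge> 2/3, the factor 1 / ln 2 is below 2. So m is at most 52 ln X,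
    and n + 1 \<le> 2 n doubles this to the constant 104.\<close>
  have "log 2 X \<le> 2 * ln X"
    using X(3) ln2_ge_two_thirds by (simp add: log_def field_simps)
  then have m_ln: "real m \<le> 52 * ln X"
    using m by linarith
  have N: "real ((n + 1) * m) \<le> 104 * real n * ln X"
  proof -
    have "real ((n + 1) * m) \<le> (2 * real n) * (52 * ln X)"
      unfolding of_nat_mult using n1 m_ln by (intro mult_mono) auto
    then show ?thesis by simp
  qed
  define A where "A = sep_alg n m M X h \<eta>"
  have "implements_sep n
      {K. convex_Rn n K \<and> ball2 n (\<lambda>_. 0) (1 / \<kappa>) \<subseteq> K \<and> K \<subseteq> ball2 n (\<lambda>_. 0) 1} \<eta> (q ^ 26) A"
    unfolding implements_sep_def A_def
  proof (intro ballI allI impI)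
    fix K orc y
    assume "K \<in> {K. convex_Rn n K \<and> ball2 n (\<lambda>_. 0) (1 / \<kappa>) \<subseteq> K \<and> K \<subseteq> ball2 n (\<lambda>_. 0) 1}"
      and orc: "mem_oracle n K (q ^ 26) orc" and y: "y \<in> Rn n"
    then interpret round_body n \<kappa> K
      using \<kappa> by unfold_locales auto
    show "1 - \<eta> \<le> measure_pmf.prob (run orc (sep_alg n m M X h \<eta> y) []) {s. sep_answer_ok n K \<eta> y s}"
    proof (rule sep_alg_correct[OF y orc \<eta>])
      show h0: "0 < h" using q by (simp add: h_def)
      show "h \<le> 1 / 2"
        using pow[of 0 14] by (simp add: h_def power_divide)
      show "M > 0" by fact
      show \<theta>0: "\<theta> > 0"
        using h0 \<kappa> n \<eta> \<open>M > 0\<close> by (simp add: \<theta>_def)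
      show "\<kappa> * (real n * (h * real M)) \<le> \<eta> / 4"
      proof -
        have "\<kappa> * (real n * (h * real M)) = (real n * \<kappa> * q) * q ^ 2 * (real M * q ^ 11)"
          using power_add[of q 1 13] power_add[of q 2 11] by (simp add: h_def mult_ac)
        also have "\<dots> \<le> \<eta> * q ^ 2 * 1"
          unfolding n\<kappa>q using Mq' \<eta> by (intro mult_left_mono) auto
        also have "\<dots> \<le> \<eta> / 4"
          using pow[of 0 2] \<eta> by (simp add: power2_eq_square)
        finally show ?thesis .
      qed
      show "2 * \<kappa> * h * real n / (real M * \<theta>) \<le> \<eta> / 2"
        using h0 \<kappa> n \<eta> \<open>M > 0\<close> by (simp add: \<theta>_def)
      show "2 * \<kappa> \<le> X"
        using \<kappa>q q \<eta> by (simp add: X(1) field_simps)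
      show "0 \<le> q ^ 26" using q by simp
      \<comment> \<open>Bisection and oracle error are each at most q^24; the exponent 26 absorbs X
        = 1 / q and \<kappa> \<le> 1 / q. Two such terms fit since 2 q < 1.\<close>
      show "X / 2 ^ m + X * \<kappa> * q ^ 26 \<le> q ^ 23"
      proof -
        have "X / 2 ^ m \<le> X / X ^ 25"
          using Xm X(3) by (intro divide_left_mono) auto
        also have "\<dots> = q ^ 24"
          using q power_add[of q 1 24] by (simp add: X(1) power_divide)
        finally have 1: "X / 2 ^ m \<le> q ^ 24" .
        have "X * \<kappa> * q ^ 26 = (X * q) * (\<kappa> * q) * q ^ 24"
          using power_add[of q 1 25] power_add[of q 1 24] by (simp add: mult_ac)
        also have "\<dots> \<le> 1 * 1 * q ^ 24"
          unfolding X(2) using \<kappa>q \<eta> \<kappa> q by (intro mult_right_mono mult_left_mono) auto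
        finally show ?thesis
          using 1 pow[of 23 1] by simp
      qed
      show "q ^ 23 \<le> \<eta> / 8"
        using pow[of 1 22] q by (simp add: power_divide)
      \<comment> \<open>Both terms are of order q^9 up to a factor n: the first is 12 / (M q), and
        in the second q^23 / h = q^9.\<close>
      show "3 * \<theta> / h + 6 * real n * q ^ 23 / h \<le> \<eta> / 8"
      proof -
        have "3 * \<theta> / h = 12 * (real n * \<kappa>) / (real M * \<eta>)"
          using h0 by (simp add: \<theta>_def)
        also have "\<dots> = 12 / (real M * q)"
          using q \<eta> n\<kappa> by (simp add: q_def)
        also have "\<dots> \<le> 12 * q ^ 9"
          using mult_left_mono[OF Mq, of 12] power_add[of q 1 9] q \<open>M > 0\<close>
          by (simp add: divide_le_eq mult_ac)
        also have "\<dots> \<le> \<eta> / 16"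
          using pow[of 1 8] q by (simp add: power_divide)
        finally have 1: "3 * \<theta> / h \<le> \<eta> / 16" .
        have "q ^ 23 = q ^ 14 * (q * q ^ 8)"
          by (simp flip: power_add power_Suc)
        then have "6 * real n * q ^ 23 / h = 6 * (real n * q) * q ^ 8"
          using q by (simp add: h_def)
        also have "\<dots> \<le> 6 * \<eta> * (1 / 2) ^ 8"
          using nq pow[of 0 8] \<eta> q by (intro mult_mono) auto
        also have "\<dots> \<le> \<eta> / 16"
          using \<eta> by (simp add: power_divide)
        finally show ?thesis using 1 by linarith
      qed
      \<comment> \<open>The crude bound ln X \<le> X is enough, as the oracle parameter is a high
        power of q.\<close>
      show "real ((n + 1) * m) * q ^ 26 \<le> \<eta> / 2"
      proof -
        have "real ((n + 1) * m) * q ^ 26 \<le> 104 * real n * X * q ^ 26"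
          using N ln_bound[of X] X(3) q
          by (intro mult_right_mono order_trans[OF N] mult_left_mono) auto
        also have "\<dots> = 104 * (real n * q) * (X * q) * q ^ 24"
          using power_add[of q 1 25] power_add[of q 1 24] by (simp add: mult_ac)
        also have "\<dots> \<le> 104 * \<eta> * 1 * (1 / 2) ^ 24"
          unfolding X(2) using nq pow[of 0 24] \<eta> q by (intro mult_mono) auto
        also have "\<dots> \<le> \<eta> / 2"
          using \<eta> by (simp add: power_divide)
        finally show ?thesis .
      qed
    qed
  qed
  then have "sep_cost n
      {K. convex_Rn n K \<and> ball2 n (\<lambda>_. 0) (1 / \<kappa>) \<subseteq> K \<and> K \<subseteq> ball2 n (\<lambda>_. 0) 1} \<eta> (q ^ 26)
      \<le> (SUP y\<in>Rn n. calls (A y))"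
    unfolding sep_cost_def by (intro INF_lower) simp
  also have "\<dots> \<le> enat ((n + 1) * m)"
    unfolding A_def by (intro SUP_least calls_sep_alg)
  finally show ?thesis
    using N unfolding q_def X_def by blast
qed

theorem theorem3p6:
  shows "\<exists>(C::real) (p::nat). C > 0 \<and> p > 0 \<and>
    (\<forall>(n::nat) (\<kappa>::real) (\<eta>::real).
       n \<ge> 1 \<longrightarrow> \<kappa> \<ge> 1 \<longrightarrow> 0 \<le> \<eta> \<longrightarrow> \<eta> < 1 / 2 \<longrightarrow>
       ereal_of_enat
         (sep_cost n
            {K. convex_Rn n K \<and> ball2 n (\<lambda>_. 0) (1 / \<kappa>) \<subseteq> K \<and> K \<subseteq> ball2 n (\<lambda>_. 0) 1}
            \<eta> ((\<eta> / (real n * \<kappa>)) ^ p))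
       \<le> ereal (C * real n) * log_ratio (real n * \<kappa>) \<eta>)"
proof (intro exI[of _ "104 :: real"] exI[of _ "26 :: nat"] conjI allI impI)
  fix n :: nat and \<kappa> \<eta> :: real
  assume n: "n \<ge> 1" and \<kappa>: "\<kappa> \<ge> 1" and \<eta>: "0 \<le> \<eta>" "\<eta> < 1 / 2"
  let ?cost = "sep_cost n
      {K. convex_Rn n K \<and> ball2 n (\<lambda>_. 0) (1 / \<kappa>) \<subseteq> K \<and> K \<subseteq> ball2 n (\<lambda>_. 0) 1}
      \<eta> ((\<eta> / (real n * \<kappa>)) ^ 26)"
  show "ereal_of_enat ?cost \<le> ereal (104 * real n) * log_ratio (real n * \<kappa>) \<eta>"
  proof (cases "\<eta> = 0")
    \<comment> \<open>The right-hand side is infinite here, because n \<ge> 1 makes the coefficient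
      positive.\<close>
    case True
    then show ?thesis using n by (simp add: log_ratio_def)
  next
    case False
    then obtain N where N: "?cost \<le> enat N" "real N \<le> 104 * real n * ln (real n * \<kappa> / \<eta>)"
      using sep_cost_le[OF n \<kappa>, of \<eta>] \<eta> by auto
    have "ereal_of_enat ?cost \<le> ereal_of_enat (enat N)"
      using N(1) by (simp only: ereal_of_enat_le_iff)
    also have "\<dots> \<le> ereal (104 * real n * ln (real n * \<kappa> / \<eta>))"
      using N(2) by simp
    finally show ?thesis using False by (simp add: log_ratio_def)
  qed
qed simp_all

end
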